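(* Let $M_3$ be a timelike non-cylindrical ruled surface with timelike base curve and spacelike ruling in $\mathbb{R}_1^3$, parametrized by $\tilde\varphi_3(u,v)=\vec\beta_3(u)+v\,\vec e_3(u)$, where $\vec\beta_3$ is the striction curve and $\vec e_3$ the unit director curve, under the standing assumptions on $\vec e_3$ and $\vec\beta_3$ given in the context. Let $P=P(u)$ be the distribution parameter of $M_3$. Then the Gaussian curvature $K=K(u,v)$ of $M_3$ is $$K=\frac{P^2}{\left(P^2-v^2\right)^2},\qquad\text{where } P^2-v^2>0.$$
   Context: $\mathbb{R}_1^3$ is $\mathbb{R}^3$ with the Lorentz metric $\langle x,y\rangle=g(x,y)=x_1y_1+x_2y_2-x_3y_3$, and $\|\vec v\|=\sqrt{|\langle \vec v,\vec v\rangle|}$. A vector $\vec v$ is spacelike if $\langle \vec v,\vec v\rangle>0$ or $\vec v=0$, timelike if $\langle \vec v,\vec v\rangle<0$, and null if $\langle \vec v,\vec v\rangle=0$ with $\vec v\neq0$. A curve is spacelike (timelike) if all its velocity vectors are. The Lorentzian product is $\vec v\wedge\vec w=(v_3w_2-v_2w_3,\;v_1w_3-v_3w_1,\;v_1w_2-v_2w_1)$. Ruled surface: a surface parametrized by $\varphi(u,v)=\vec\alpha(u)+v\,\vec\gamma(u)$, $(u,v)\in I\times\mathbb{R}$, with $\vec\alpha,\vec\gamma$ smooth curves in $\mathbb{R}_1^3$ and $\vec\alpha'$ nowhere zero. It is non-cylindrical if $\vec\gamma\wedge\vec\gamma'$ is nowhere zero. Its striction curve is $\vec\beta=\vec\alpha-\frac{\langle\vec\alpha',\vec\gamma'\rangle}{\langle\vec\gamma',\vec\gamma'\rangle}\vec\gamma$.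 A non-cylindrical ruled surface is reparametrized as $\tilde\varphi(u,v)=\vec\beta(u)+v\,\vec e(u)$ with $\|\vec e\|=1$, $\langle\vec\beta',\vec e'\rangle=0$ and $\vec\beta$ the striction curve. A surface is timelike if its induced metric is Lorentzian, i.e. its normal is spacelike; for $M_3$ this corresponds to the condition $P(u)^2-v^2>0$. Standing assumptions for $M_3$: $\vec e_3$ is spacelike with $\langle\vec e_3,\vec e_3\rangle=1$; with $\vec n_3=\vec e_3'/\|\vec e_3'\|$ and $\vec\xi_3=\vec e_3\wedge\vec e_3'/\|\vec e_3\wedge\vec e_3'\|$, the frame $\{\vec e_3,\vec n_3,\vec\xi_3\}$ is orthonormal of type {space, space, time}, i.e. $\langle\vec e_3,\vec e_3\rangle=\langle\vec n_3,\vec n_3\rangle=-\langle\vec\xi_3,\vec\xi_3\rangle=1$ and the vectors are mutually orthogonal (in particular $\vec e_3'$ is spacelike). The striction curve is timelike and satisfies $\vec\beta_3'=\sinh\sigma_3\,\vec e_3+\cosh\sigma_3\,\vec\xi_3$ for a smooth function $\sigma_3=\sigma_3(u)$. Distribution parameter: $P=\dfrac{\det(\vec\beta',\vec e,\vec e')}{\langle\vec e',\vec e'\rangle}$ (a function of $u$), with $\det$ the usual determinant in coordinates. Gaussian curvature (the sign convention used here): $K=\dfrac{LM-N^2}{EG-F^2}$, where $E=\langle\tilde\varphi_u,\tilde\varphi_u\rangle$, $F=\langle\tilde\varphi_u,\tilde\varphi_v\rangle$, $G=\langle\tilde\varphi_v,\tilde\varphi_v\rangle$, $L=\langle\tilde\varphi_{uu},\vec\eta\rangle$,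 $N=\langle\tilde\varphi_{uv},\vec\eta\rangle$, $M=\langle\tilde\varphi_{vv},\vec\eta\rangle$, and $\vec\eta=\dfrac{\tilde\varphi_u\wedge\tilde\varphi_v}{\|\tilde\varphi_u\wedge\tilde\varphi_v\|}$ is the unit normal. *)

theory Defs
  imports "HOL-Analysis.Analysis"
begin

section \<open>Lorentz--Minkowski 3-space\<close>

definition lorentz :: "real^3 \<Rightarrow> real^3 \<Rightarrow> real" where
  "lorentz x y = x$1 * y$1 + x$2 * y$2 - x$3 * y$3"

definition lnorm :: "real^3 \<Rightarrow> real" where
  "lnorm x = sqrt \<bar>lorentz x x\<bar>"

definition spacelike :: "real^3 \<Rightarrow> bool" where
  "spacelike x \<longleftrightarrow> lorentz x x > 0 \<or> x = 0"

definition timelike :: "real^3 \<Rightarrow> bool" where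
  "timelike x \<longleftrightarrow> lorentz x x < 0"

text \<open>With this sign convention \<open>lorentz (lcross v w) x\<close> is minus the determinant with
  rows \<open>v\<close>, \<open>w\<close>, \<open>x\<close>.\<close>

definition lcross :: "real^3 \<Rightarrow> real^3 \<Rightarrow> real^3" where
  "lcross v w = vector [v$3 * w$2 - v$2 * w$3, v$1 * w$3 - v$3 * w$1, v$1 * w$2 - v$2 * w$1]"

section \<open>Smooth curves\<close>

abbreviation velocity :: "(real \<Rightarrow> 'a::real_normed_vector) \<Rightarrow> real \<Rightarrow> 'a" where
  "velocity c \<equiv> (\<lambda>t. vector_derivative c (at t))"

text \<open>Only used on open parameter sets, so that the two-sided derivatives depend only on the
  values on \<open>I\<close>.\<close>

definition smooth_curve_on :: "real set \<Rightarrow> (real \<Rightarrow> 'a::real_normed_vector) \<Rightarrow> bool" where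
  "smooth_curve_on I c \<longleftrightarrow> (\<forall>n. \<forall>t\<in>I. (velocity ^^ n) c differentiable (at t))"

definition open_interval :: "real set \<Rightarrow> bool" where
  "open_interval I \<longleftrightarrow> open I \<and> is_interval I \<and> I \<noteq> {}"

definition timelike_curve_on :: "real set \<Rightarrow> (real \<Rightarrow> real^3) \<Rightarrow> bool" where
  "timelike_curve_on I c \<longleftrightarrow> (\<forall>u\<in>I. timelike (velocity c u))"

section \<open>Ruled surfaces\<close>

definition ruled_param :: "(real \<Rightarrow> real^3) \<Rightarrow> (real \<Rightarrow> real^3) \<Rightarrow> real \<Rightarrow> real \<Rightarrow> real^3" where
  "ruled_param \<alpha> \<gamma> u v = \<alpha> u + v *\<^sub>R \<gamma> u"

definition ruled_surface_on :: "real set \<Rightarrow> (real \<Rightarrow> real^3) \<Rightarrow> (real \<Rightarrow> real^3) \<Rightarrow> bool" where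
  "ruled_surface_on I \<alpha> \<gamma> \<longleftrightarrow>
     smooth_curve_on I \<alpha> \<and> smooth_curve_on I \<gamma> \<and> (\<forall>u\<in>I. velocity \<alpha> u \<noteq> 0)"

definition non_cylindrical_on :: "real set \<Rightarrow> (real \<Rightarrow> real^3) \<Rightarrow> bool" where
  "non_cylindrical_on I \<gamma> \<longleftrightarrow> (\<forall>u\<in>I. lcross (\<gamma> u) (velocity \<gamma> u) \<noteq> 0)"

definition striction_curve :: "(real \<Rightarrow> real^3) \<Rightarrow> (real \<Rightarrow> real^3) \<Rightarrow> real \<Rightarrow> real^3" where
  "striction_curve \<alpha> \<gamma> u =
     \<alpha> u - (lorentz (velocity \<alpha> u) (velocity \<gamma> u) / lorentz (velocity \<gamma> u) (velocity \<gamma> u)) *\<^sub>R \<gamma> u"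

text \<open>\<open>\<beta> + v e\<close> is a normalised parametrisation: unit director curve, and the base curve is the
  striction curve of the surface.\<close>

definition striction_param_on :: "real set \<Rightarrow> (real \<Rightarrow> real^3) \<Rightarrow> (real \<Rightarrow> real^3) \<Rightarrow> bool" where
  "striction_param_on I \<beta> e \<longleftrightarrow>
     (\<forall>u\<in>I. lnorm (e u) = 1 \<and> lorentz (velocity \<beta> u) (velocity e u) = 0 \<and>
            striction_curve \<beta> e u = \<beta> u)"

definition normal_dir :: "(real \<Rightarrow> real^3) \<Rightarrow> real \<Rightarrow> real^3" where
  "normal_dir e u = (1 / lnorm (velocity e u)) *\<^sub>R velocity e u"

definition binormal_dir :: "(real \<Rightarrow> real^3) \<Rightarrow> real \<Rightarrow> real^3" where
  "binormal_dir e u = (1 / lnorm (lcross (e u) (velocity e u))) *\<^sub>R lcross (e u) (velocity e u)"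

definition orthonormal_space_space_time :: "real^3 \<Rightarrow> real^3 \<Rightarrow> real^3 \<Rightarrow> bool" where
  "orthonormal_space_space_time x y z \<longleftrightarrow>
     lorentz x x = 1 \<and> lorentz y y = 1 \<and> lorentz z z = -1 \<and>
     lorentz x y = 0 \<and> lorentz x z = 0 \<and> lorentz y z = 0"

definition distribution_parameter ::
    "(real \<Rightarrow> real^3) \<Rightarrow> (real \<Rightarrow> real^3) \<Rightarrow> real \<Rightarrow> real" where
  "distribution_parameter \<beta> e u =
     det (vector [velocity \<beta> u, e u, velocity e u] :: real^3^3)
       / lorentz (velocity e u) (velocity e u)"

section \<open>Geometry of a parametrised surface\<close>

definition du :: "(real \<Rightarrow> real \<Rightarrow> real^3) \<Rightarrow> real \<Rightarrow> real \<Rightarrow> real^3" where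
  "du \<phi> u v = vector_derivative (\<lambda>s. \<phi> s v) (at u)"

definition dv :: "(real \<Rightarrow> real \<Rightarrow> real^3) \<Rightarrow> real \<Rightarrow> real \<Rightarrow> real^3" where
  "dv \<phi> u v = vector_derivative (\<lambda>t. \<phi> u t) (at v)"

text \<open>The induced metric is Lorentzian at a point: the restriction of the ambient metric to the
  span of the coordinate vectors has signature \<open>(1,1)\<close>. The basis \<open>x, y\<close> is automatically
  independent, so this includes regularity of \<open>\<phi>\<close> at the point.\<close>

definition timelike_surface_at :: "(real \<Rightarrow> real \<Rightarrow> real^3) \<Rightarrow> real \<Rightarrow> real \<Rightarrow> bool" where
  "timelike_surface_at \<phi> u v \<longleftrightarrow>
     (\<exists>x y. span {x, y} = span {du \<phi> u v, dv \<phi> u v} \<and>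
            lorentz x x = 1 \<and> lorentz y y = -1 \<and> lorentz x y = 0)"

definition unit_normal :: "(real \<Rightarrow> real \<Rightarrow> real^3) \<Rightarrow> real \<Rightarrow> real \<Rightarrow> real^3" where
  "unit_normal \<phi> u v =
     (1 / lnorm (lcross (du \<phi> u v) (dv \<phi> u v))) *\<^sub>R lcross (du \<phi> u v) (dv \<phi> u v)"

text \<open>The letters follow the convention in which \<open>N\<close> is the mixed coefficient and \<open>M\<close> the
  coefficient of \<open>dv\<^sup>2\<close>. The sign of \<open>K\<close> is also that convention: there is no
  extra factor for the causal character of the normal.\<close>

definition gaussian_curvature :: "(real \<Rightarrow> real \<Rightarrow> real^3) \<Rightarrow> real \<Rightarrow> real \<Rightarrow> real" where
  "gaussian_curvature \<phi> u v =
     (let E = lorentz (du \<phi> u v) (du \<phi> u v);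
          F = lorentz (du \<phi> u v) (dv \<phi> u v);
          G = lorentz (dv \<phi> u v) (dv \<phi> u v);
          L = lorentz (du (du \<phi>) u v) (unit_normal \<phi> u v);
          N = lorentz (dv (du \<phi>) u v) (unit_normal \<phi> u v);
          M = lorentz (dv (dv \<phi>) u v) (unit_normal \<phi> u v)
      in (L * M - N\<^sup>2) / (E * G - F\<^sup>2))"

end

theory Submission
  imports Defs
begin

text \<open>Write \<open>a = \<beta>' + v e'\<close> for the first coordinate vector of the surface; the second one is \<open>e\<close>.
  Because the surface is affine in \<open>v\<close>, its second derivatives are \<open>\<phi>\<^sub>v\<^sub>v = 0\<close> and
  \<open>\<phi>\<^sub>u\<^sub>v = e'\<close>. Hence the curvature is \<open>-N\<^sup>2 / D\<close> with \<open>D = EG - F\<^sup>2\<close>.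
  Up to sign, \<open>N\<close> is the determinant of \<open>a, e, e'\<close>, which equals that of \<open>\<beta>', e, e'\<close>, divided by the
  length of \<open>a \<and> e\<close>. The Lorentzian Lagrange identity gives that vector the square \<open>-D\<close>, so
  every ruled surface satisfies \<open>K = - det(\<beta>', e, e')\<^sup>2 / (\<bar>D\<bar> D)\<close>
  (\<open>gaussian_curvature_ruled\<close>).

  The standing assumptions determine both ingredients. With \<open>k = \<parallel>e'\<parallel>\<close>, the expansion of \<open>\<beta>'\<close> in the
  orthonormal frame gives \<open>det(\<beta>', e, e') = k cosh \<sigma>\<close> and \<open>D = v\<^sup>2 k\<^sup>2 - cosh\<^sup>2 \<sigma>\<close>. So
  \<open>P = cosh \<sigma> / k\<close> and \<open>D = - k\<^sup>2 (P\<^sup>2 - v\<^sup>2)\<close>, and substitution yields the formula for \<open>K\<close>. Finally, \<open>D\<close> is the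
  Gram determinant of the tangent plane, whose sign does not depend on the basis; the plane is
  Lorentzian exactly if \<open>D < 0\<close> (\<open>lorentzian_plane_iff\<close>), that is, if \<open>P\<^sup>2 - v\<^sup>2 > 0\<close>.\<close>

section \<open>Algebra of the Lorentz metric\<close>

lemma lorentz_commute: "lorentz x y = lorentz y x"
  by (simp add: lorentz_def)

lemma lorentz_add_left: "lorentz (x + y) z = lorentz x z + lorentz y z"
  by (simp add: lorentz_def algebra_simps)

lemma lorentz_add_right: "lorentz z (x + y) = lorentz z x + lorentz z y"
  by (simp add: lorentz_def algebra_simps)

lemma lorentz_diff_left: "lorentz (x - y) z = lorentz x z - lorentz y z"
  by (simp add: lorentz_def algebra_simps)

lemma lorentz_diff_right: "lorentz z (x - y) = lorentz z x - lorentz z y"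
  by (simp add: lorentz_def algebra_simps)

lemma lorentz_scaleR_left: "lorentz (c *\<^sub>R x) z = c * lorentz x z"
  by (simp add: lorentz_def algebra_simps)

lemma lorentz_scaleR_right: "lorentz z (c *\<^sub>R x) = c * lorentz z x"
  by (simp add: lorentz_def algebra_simps)

lemma lorentz_zero_left: "lorentz 0 z = 0"
  by (simp add: lorentz_def)

lemmas lorentz_bilinear =
  lorentz_add_left lorentz_add_right lorentz_diff_left lorentz_diff_right
  lorentz_scaleR_left lorentz_scaleR_right

lemma lnorm_squared: "(lnorm x)\<^sup>2 = \<bar>lorentz x x\<bar>"
  by (simp add: lnorm_def)

text \<open>The Lagrange identity carries the opposite sign from the Euclidean one, so a
  normal to a plane is spacelike exactly if the plane is Lorentzian.\<close>

lemma lorentz_lcross_lcross: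
  "lorentz (lcross x y) (lcross x y) = (lorentz x y)\<^sup>2 - lorentz x x * lorentz y y"
  by (simp add: lorentz_def lcross_def vector_3 power2_eq_square algebra_simps)

text \<open>A determinant is unchanged by adding a multiple of one row to another; this makes the
  numerator of the mixed coefficient \<open>N\<close> of a ruled surface constant along each ruling.\<close>

lemma lorentz_lcross_add_scaleR:
  "lorentz z (lcross (x + c *\<^sub>R z) y) = - det (vector [x, y, z] :: real^3^3)"
  by (simp add: lorentz_def lcross_def vector_3 det_3 algebra_simps)

lemma det_eq_lorentz_lcross:
  "det (vector [x, y, z] :: real^3^3) = - lorentz x (lcross y z)"
  by (simp add: lorentz_def lcross_def vector_3 det_3 algebra_simps)

section \<open>Lorentzian planes\<close>

text \<open>The sign of the Gram determinant is an invariant of the plane: a change of basis multiplies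
  it by the square of the determinant of the transition matrix.\<close>

lemma gram_determinant_change_of_basis:
  assumes "x = p *\<^sub>R a + q *\<^sub>R b" and "y = r *\<^sub>R a + s *\<^sub>R b"
  shows "lorentz x x * lorentz y y - (lorentz x y)\<^sup>2 =
    (p * s - q * r)\<^sup>2 * (lorentz a a * lorentz b b - (lorentz a b)\<^sup>2)"
  unfolding assms
  by (simp add: lorentz_bilinear lorentz_commute[of b a] power2_eq_square algebra_simps)

text \<open>In one direction, an orthonormal basis has Gram determinant \<open>-1\<close>. In the other, the
  Gram--Schmidt process started at \<open>b\<close> produces such a basis.\<close>

lemma lorentzian_plane_iff:
  assumes b: "lorentz b b = 1"
  shows "(\<exists>x y. span {x, y} = span {a, b} \<and>
      lorentz x x = 1 \<and> lorentz y y = -1 \<and> lorentz x y = 0) \<longleftrightarrow>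
    lorentz a a * lorentz b b - (lorentz a b)\<^sup>2 < 0" (is "?L \<longleftrightarrow> ?D < 0")
proof
  assume ?L
  then obtain x y where xy: "span {x, y} = span {a, b}"
    and on: "lorentz x x = 1" "lorentz y y = -1" "lorentz x y = 0"
    by blast
  have coords: "\<exists>p q. z = p *\<^sub>R a + q *\<^sub>R b" if "z \<in> {x, y}" for z
  proof -
    have "z \<in> span {a, b}"
      using that unfolding xy[symmetric] by (rule span_base)
    then obtain p q where "z - p *\<^sub>R a = q *\<^sub>R b"
      by (auto simp: span_breakdown_eq)
    then show ?thesis
      by (metis diff_eq_eq add.commute)
  qed
  obtain p q where x: "x = p *\<^sub>R a + q *\<^sub>R b"
    using coords by blast
  obtain r s where y: "y = r *\<^sub>R a + s *\<^sub>R b"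
    using coords by blast
  from gram_determinant_change_of_basis[OF x y] on
  have eq: "(p * s - q * r)\<^sup>2 * ?D = -1"
    by simp
  show "?D < 0"
  proof (rule ccontr)
    assume "\<not> ?D < 0"
    then have "(p * s - q * r)\<^sup>2 * ?D \<ge> 0"
      by (intro mult_nonneg_nonneg) auto
    with eq show False
      by simp
  qed
next
  assume neg: "?D < 0"
  define c where "c = sqrt (- ?D)"
  define y where "y = (1 / c) *\<^sub>R (a - lorentz a b *\<^sub>R b)"
  have c: "c > 0" "c\<^sup>2 = - ?D"
    using neg by (simp_all add: c_def)
  have "lorentz y y = (lorentz a a - (lorentz a b)\<^sup>2) / c\<^sup>2"
    using b by (simp add: y_def lorentz_bilinear lorentz_commute[of b a] power2_eq_square)
  then have "lorentz y y = -1"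
    using b neg c by (simp add: divide_eq_minus_1_iff)
  moreover have "lorentz b y = 0"
    using b by (simp add: y_def lorentz_bilinear lorentz_commute[of b a])
  moreover have "span {b, y} = span {a, b}"
  proof -
    have "y = (1 / c) *\<^sub>R a + (- (lorentz a b / c)) *\<^sub>R b"
      by (simp add: y_def algebra_simps)
    then have "y \<in> span {a, b}"
      by (metis span_add span_scale span_base insertI1 insertI2)
    moreover have "a = c *\<^sub>R y + lorentz a b *\<^sub>R b"
      using c(1) by (simp add: y_def)
    then have "a \<in> span {b, y}"
      by (metis span_add span_scale span_base insertI1 insertI2)
    ultimately show ?thesis
      by (simp add: span_eq span_base)
  qed
  ultimately show ?L
    using b by blast
qed

section \<open>Curvature of a ruled surface\<close>

lemma dv_ruled_param: "dv (ruled_param \<beta> e) u v = e u"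
  unfolding dv_def ruled_param_def
  by (rule vector_derivative_at) (auto intro!: derivative_eq_intros)

lemma du_ruled_param:
  assumes "\<beta> differentiable at u" and "e differentiable at u"
  shows "du (ruled_param \<beta> e) u v = velocity \<beta> u + v *\<^sub>R velocity e u"
proof -
  have "(\<beta> has_vector_derivative velocity \<beta> u) (at u)"
    "(e has_vector_derivative velocity e u) (at u)"
    using assms by (simp_all add: vector_derivative_works)
  then have "((\<lambda>s. \<beta> s + v *\<^sub>R e s) has_vector_derivative
      velocity \<beta> u + v *\<^sub>R velocity e u) (at u)"
    by (auto intro!: derivative_eq_intros)
  then show ?thesis
    by (simp add: du_def ruled_param_def vector_derivative_at)
qed

lemma dv_dv_ruled_param: "dv (dv (ruled_param \<beta> e)) u v = 0"
  using dv_ruled_param[of \<beta> e] by (simp add: dv_def)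

lemma dv_du_ruled_param:
  assumes "\<beta> differentiable at u" and "e differentiable at u"
  shows "dv (du (ruled_param \<beta> e)) u v = velocity e u"
  unfolding dv_def du_ruled_param[OF assms]
  by (rule vector_derivative_at) (auto intro!: derivative_eq_intros)

text \<open>The absolute value comes from the normalisation of \<open>a \<and> e\<close>, which has square \<open>- D\<close>.\<close>

lemma gaussian_curvature_ruled:
  fixes v :: real
  assumes "\<beta> differentiable at u" and "e differentiable at u"
  defines "a \<equiv> velocity \<beta> u + v *\<^sub>R velocity e u"
  defines "D \<equiv> lorentz a a * lorentz (e u) (e u) - (lorentz a (e u))\<^sup>2"
  shows "gaussian_curvature (ruled_param \<beta> e) u v =
    - (det (vector [velocity \<beta> u, e u, velocity e u] :: real^3^3))\<^sup>2 / (\<bar>D\<bar> * D)"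
proof -
  let ?c = "lcross a (e u)"
  let ?N = "lorentz (velocity e u) (unit_normal (ruled_param \<beta> e) u v)"
  have a: "du (ruled_param \<beta> e) u v = a"
    unfolding a_def by (rule du_ruled_param[OF assms(1,2)])
  have "?N = lorentz (velocity e u) ?c / lnorm ?c"
    by (simp add: unit_normal_def a dv_ruled_param lorentz_scaleR_right)
  then have "?N\<^sup>2 = (lorentz (velocity e u) ?c)\<^sup>2 / \<bar>lorentz ?c ?c\<bar>"
    by (simp add: power_divide lnorm_squared)
  also have "lorentz (velocity e u) ?c = - det (vector [velocity \<beta> u, e u, velocity e u] :: real^3^3)"
    unfolding a_def by (simp add: lorentz_lcross_add_scaleR)
  also have "\<bar>lorentz ?c ?c\<bar> = \<bar>D\<bar>"
    by (simp add: lorentz_lcross_lcross D_def)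
  finally have N: "?N\<^sup>2 = (det (vector [velocity \<beta> u, e u, velocity e u] :: real^3^3))\<^sup>2 / \<bar>D\<bar>"
    by simp
  have "gaussian_curvature (ruled_param \<beta> e) u v = - ?N\<^sup>2 / D"
    by (simp add: gaussian_curvature_def Let_def dv_dv_ruled_param dv_du_ruled_param[OF assms(1,2)]
        a dv_ruled_param lorentz_zero_left D_def)
  then show ?thesis
    by (simp add: N)
qed

section \<open>The frame along the striction curve\<close>

text \<open>A zero derivative would make the normalised vector zero as well, contradicting that it has
  square \<open>1\<close>.\<close>

lemma velocity_square_of_unit_normal_dir:
  assumes "lorentz (normal_dir e u) (normal_dir e u) = 1"
  shows "lnorm (velocity e u) > 0"
    and "lorentz (velocity e u) (velocity e u) = (lnorm (velocity e u))\<^sup>2"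
proof -
  have sq: "lorentz (velocity e u) (velocity e u) / (lnorm (velocity e u))\<^sup>2 = 1"
    using assms by (auto simp: normal_dir_def lorentz_bilinear power2_eq_square)
  then have "lnorm (velocity e u) \<noteq> 0"
    by auto
  with sq show "lorentz (velocity e u) (velocity e u) = (lnorm (velocity e u))\<^sup>2"
    by (metis divide_eq_1_iff)
  show "lnorm (velocity e u) > 0"
    using \<open>lnorm (velocity e u) \<noteq> 0\<close> by (simp add: lnorm_def order_less_le)
qed

text \<open>By the Lagrange identity, \<open>e \<and> e'\<close> has the length \<open>k\<close> of \<open>e'\<close>, so it equals \<open>k\<close> times the binormal;
  the determinant then reads off the binormal component \<open>h\<close> of \<open>\<beta>'\<close>.\<close>

lemma striction_frame_det_and_gram:
  fixes g h v :: real
  assumes frame: "orthonormal_space_space_time (e u) (normal_dir e u) (binormal_dir e u)"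
    and \<beta>': "velocity \<beta> u = g *\<^sub>R e u + h *\<^sub>R binormal_dir e u"
  defines "k \<equiv> lnorm (velocity e u)"
  defines "a \<equiv> velocity \<beta> u + v *\<^sub>R velocity e u"
  shows "det (vector [velocity \<beta> u, e u, velocity e u] :: real^3^3) = k * h"
    and "lorentz a a * lorentz (e u) (e u) - (lorentz a (e u))\<^sup>2 = v\<^sup>2 * k\<^sup>2 - h\<^sup>2"
proof -
  note on = frame[unfolded orthonormal_space_space_time_def]
  have k: "k > 0" "lorentz (velocity e u) (velocity e u) = k\<^sup>2"
    using velocity_square_of_unit_normal_dir[of e u] on by (simp_all add: k_def)
  have e': "velocity e u = k *\<^sub>R normal_dir e u"
    using k(1) by (simp add: normal_dir_def k_def)
  have orth: "lorentz (e u) (velocity e u) = 0"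
    using on by (simp add: e' lorentz_bilinear)
  have "lnorm (lcross (e u) (velocity e u)) = k"
    using on k orth by (simp add: lnorm_def lorentz_lcross_lcross)
  then have "lcross (e u) (velocity e u) = k *\<^sub>R binormal_dir e u"
    using k(1) by (simp add: binormal_dir_def)
  then show "det (vector [velocity \<beta> u, e u, velocity e u] :: real^3^3) = k * h"
    using on by (simp add: det_eq_lorentz_lcross \<beta>' lorentz_bilinear)
  have a: "a = g *\<^sub>R e u + h *\<^sub>R binormal_dir e u + (v * k) *\<^sub>R normal_dir e u"
    by (simp add: a_def \<beta>' e')
  have rev: "lorentz (normal_dir e u) (e u) = 0" "lorentz (binormal_dir e u) (e u) = 0"
    "lorentz (binormal_dir e u) (normal_dir e u) = 0"
    using on by (simp_all add: lorentz_commute)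
  have "lorentz a (e u) = g"
    using on rev by (simp add: a lorentz_bilinear)
  moreover have "lorentz a a = g\<^sup>2 - h\<^sup>2 + (v * k)\<^sup>2"
    using on rev by (simp add: a lorentz_bilinear power2_eq_square)
  ultimately show "lorentz a a * lorentz (e u) (e u) - (lorentz a (e u))\<^sup>2 = v\<^sup>2 * k\<^sup>2 - h\<^sup>2"
    using on by (simp add: power_mult_distrib)
qed

theorem theorem6p1:
  fixes I :: "real set"
    and \<beta> e :: "real \<Rightarrow> real^3"
    and \<sigma> :: "real \<Rightarrow> real"
  assumes "open_interval I"
    and "ruled_surface_on I \<beta> e"
    and "non_cylindrical_on I e"
    and "striction_param_on I \<beta> e"
    and "\<forall>u\<in>I. spacelike (e u) \<and> lorentz (e u) (e u) = 1"
    and "\<forall>u\<in>I. orthonormal_space_space_time (e u) (normal_dir e u) (binormal_dir e u)"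
    and "timelike_curve_on I \<beta>"
    and "smooth_curve_on I \<sigma>"
    and "\<forall>u\<in>I. velocity \<beta> u = sinh (\<sigma> u) *\<^sub>R e u + cosh (\<sigma> u) *\<^sub>R binormal_dir e u"
  shows "\<forall>u\<in>I. \<forall>v.
     (timelike_surface_at (ruled_param \<beta> e) u v \<longleftrightarrow> (distribution_parameter \<beta> e u)\<^sup>2 - v\<^sup>2 > 0) \<and>
     (timelike_surface_at (ruled_param \<beta> e) u v \<longrightarrow>
        gaussian_curvature (ruled_param \<beta> e) u v =
          (distribution_parameter \<beta> e u)\<^sup>2 / ((distribution_parameter \<beta> e u)\<^sup>2 - v\<^sup>2)\<^sup>2)"
proof (intro ballI allI)
  fix u v
  assume u: "u \<in> I"
  let ?P = "distribution_parameter \<beta> e u"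
  define k where "k = lnorm (velocity e u)"
  define h where "h = cosh (\<sigma> u)"
  define a where "a = velocity \<beta> u + v *\<^sub>R velocity e u"
  define D where "D = lorentz a a * lorentz (e u) (e u) - (lorentz a (e u))\<^sup>2"
  have "\<forall>n. (velocity ^^ n) \<beta> differentiable at u" "\<forall>n. (velocity ^^ n) e differentiable at u"
    using assms(2) u by (auto simp: ruled_surface_on_def smooth_curve_on_def)
  from this[THEN spec, of 0]
  have diff: "\<beta> differentiable at u" "e differentiable at u"
    by simp_all
  have frame: "orthonormal_space_space_time (e u) (normal_dir e u) (binormal_dir e u)"
    using assms(6) u by blast
  have \<beta>': "velocity \<beta> u = sinh (\<sigma> u) *\<^sub>R e u + h *\<^sub>R binormal_dir e u"
    using assms(9) u by (simp add: h_def)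
  have k: "k > 0" "lorentz (velocity e u) (velocity e u) = k\<^sup>2"
    using velocity_square_of_unit_normal_dir[of e u] frame
    by (simp_all add: k_def orthonormal_space_space_time_def)
  have det: "det (vector [velocity \<beta> u, e u, velocity e u] :: real^3^3) = k * h"
    and "D = v\<^sup>2 * k\<^sup>2 - h\<^sup>2"
    using striction_frame_det_and_gram[OF frame \<beta>'] by (simp_all add: k_def D_def a_def)
  moreover have "?P = h / k"
    using k by (simp add: distribution_parameter_def det power2_eq_square)
  then have h: "h = k * ?P"
    using k(1) by simp
  ultimately have D: "D = - (k\<^sup>2 * (?P\<^sup>2 - v\<^sup>2))"
    by (simp add: power_mult_distrib algebra_simps)
  have "lorentz (e u) (e u) = 1"
    using assms(5) u by blast
  then have "timelike_surface_at (ruled_param \<beta> e) u v \<longleftrightarrow> D < 0"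
    unfolding timelike_surface_at_def du_ruled_param[OF diff] dv_ruled_param D_def a_def
    by (rule lorentzian_plane_iff)
  then have iff: "timelike_surface_at (ruled_param \<beta> e) u v \<longleftrightarrow> ?P\<^sup>2 - v\<^sup>2 > 0"
    using k(1) by (simp add: D zero_less_mult_iff)
  have "gaussian_curvature (ruled_param \<beta> e) u v = ?P\<^sup>2 / (?P\<^sup>2 - v\<^sup>2)\<^sup>2"
    if pos: "?P\<^sup>2 - v\<^sup>2 > 0"
  proof -
    have "gaussian_curvature (ruled_param \<beta> e) u v = - (k * h)\<^sup>2 / (\<bar>D\<bar> * D)"
      using gaussian_curvature_ruled[OF diff, of v] by (simp add: det D_def a_def)
    also have "D < 0"
      using k(1) pos by (simp add: D)
    then have "\<bar>D\<bar> * D = - D\<^sup>2"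
      by (simp add: power2_eq_square)
    also have "- (k * h)\<^sup>2 / - D\<^sup>2 = (k ^ 4 * ?P\<^sup>2) / (k ^ 4 * (?P\<^sup>2 - v\<^sup>2)\<^sup>2)"
      by (subst h) (simp add: D power_mult_distrib flip: power_add power_mult)
    also have "\<dots> = ?P\<^sup>2 / (?P\<^sup>2 - v\<^sup>2)\<^sup>2"
      using k(1) by simp
    finally show ?thesis .
  qed
  with iff show "(timelike_surface_at (ruled_param \<beta> e) u v \<longleftrightarrow> ?P\<^sup>2 - v\<^sup>2 > 0) \<and>
      (timelike_surface_at (ruled_param \<beta> e) u v \<longrightarrow>
        gaussian_curvature (ruled_param \<beta> e) u v = ?P\<^sup>2 / (?P\<^sup>2 - v\<^sup>2)\<^sup>2)"
    by blast
qed

end
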